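(* Let $(F_1,\dots,F_N)$ be a non-degenerate iterated function system of surjective maps on a complete metric space $(T,d)$, with invariant set $K$, let $X=\{1,\dots,N\}^\infty$ with shift map $\sigma$, and let $L$ be the associated fractafold bundle, with projection $\pi:L\to X$, $\pi(x,t)=x$. Let $\mathcal{G}=\mathcal{G}(X,\sigma)$ be the Renault–Deaconu groupoid associated to $\sigma$, and let $\mathcal{G}*L=\{((x,m-n,y),(y,t)):(x,m-n,y)\in\mathcal{G},\ (y,t)\in L\}$. Then $\mathcal{G}$ acts on the left on $L$ (with respect to $\pi$) via the map $((x,m-n,y),(y,t))\mapsto(x,m-n,y)\cdot(y,t)$ defined on $\mathcal{G}*L$, where $$(x,m-n,y)\cdot(y,t)=\bigl(x,\,F_{x(m)}^{-1}\circ F_{y(n)}(t)\bigr)$$ (for $m,n$ with $\sigma^m(x)=\sigma^n(y)$). Moreover, the action map $\mathcal{G}*L\to L$ is open.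
   Context: Iterated function system: $(T,d)$ is a complete metric space and $F_1,\dots,F_N:T\to T$ are maps for which there are constants $0<r_i\le R_i<1$ with $r_i d(t,t')\le d(F_i(t),F_i(t'))\le R_i d(t,t')$ for all $t,t'\in T$ (non-degeneracy); each $F_i$ is surjective, hence a homeomorphism. $K\subset T$ is the unique (non-empty) compact set with $K=F_1(K)\cup\dots\cup F_N(K)$. Words: $W=\{1,\dots,N\}$, $W^*=\bigcup_{n\in\mathbb{N}}W^n$, and $X=W^\infty$ is the space of infinite sequences with the topology generated by the cylinders $Z(\omega)=\{x\in X:x_i=\omega_i,\ i=1,\dots,|\omega|\}$, $\omega\in W^*$. The shift $\sigma(x_1x_2x_3\cdots)=x_2x_3\cdots$ is a local homeomorphism of $X$. For $\omega\in W^n$, $F_\omega=F_{\omega_n}\circ\dots\circ F_{\omega_1}$ and $F_\omega^{-1}=F_{\omega_1}^{-1}\circ\dots\circ F_{\omega_n}^{-1}$ (identity for the empty word). $x(k)=x_1\cdots x_k$. Fractafold bundle: for $\omega\in W^n$ put $L_n(\omega)=F_\omega^{-1}(K)$; for $n\ge0$ let $L_n=\bigsqcup_{\omega\in W^n}Z(\omega)\times L_n(\omega)\subset X\times T$ with the subspace topology. Then $L_n\subset L_{n+1}$, and $L=\bigcup_{n\ge0}L_n$ with the inductive limit topology: $U\subset L$ is open iff $U\cap L_n$ is open in $L_n$ for every $n\ge0$. The projection $\pi$ is continuous and open. Renault–Deaconu groupoid: for a local homeomorphism $\sigma:X\to X$, $$\mathcal{G}(X,\sigma)=\{(x,m-n,y)\in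 X\times\mathbb{Z}\times X:\ m,n\ge 0,\ \sigma^m(x)=\sigma^n(y)\},$$ with $(x,m,y)(y,n,w)=(x,m+n,w)$, $(x,n,y)^{-1}=(y,-n,x)$, $r(x,n,y)=x$, $s(x,n,y)=y$ (unit space identified with $X$ via $(x,0,x)\mapsto x$). A basis for the topology consists of the sets $\{(x,m-n,y):\sigma^m(x)=\sigma^n(y),\ x\in U,\ y\in V\}$, where $m,n\in\mathbb{N}$, $U,V\subset X$ are open, $\sigma^m|_U$ and $\sigma^n|_V$ are injective, and $\sigma^m(U)=\sigma^n(V)$. Left action: for a topological groupoid $G$ with unit space $X$ and a continuous open map $\rho:Z\to X$, put $G*Z=\{(\gamma,z)\in G\times Z:s(\gamma)=\rho(z)\}$ with the topology inherited from $G\times Z$. A left action of $G$ on $Z$ is a continuous map $G*Z\to Z$, $(\gamma,z)\mapsto\gamma\cdot z$, such that $\rho(\gamma\cdot z)=r(\gamma)$, $\gamma_2\cdot(\gamma_1\cdot z)=(\gamma_2\gamma_1)\cdot z$, and $\rho(z)\cdot z=z$. *)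

theory Defs
  imports "HOL-Analysis.Analysis" "HOL-Library.Stream"
begin

section \<open>Iterated function systems\<close>

definition nondegenerate_ifs :: "nat \<Rightarrow> (nat \<Rightarrow> 'a::metric_space \<Rightarrow> 'a) \<Rightarrow> bool" where
  "nondegenerate_ifs N F \<longleftrightarrow>
     1 \<le> N \<and>
     (\<forall>i\<in>{1..N}. \<exists>r R. 0 < r \<and> r \<le> R \<and> R < 1 \<and>
        (\<forall>t t'. r * dist t t' \<le> dist (F i t) (F i t') \<and>
                dist (F i t) (F i t') \<le> R * dist t t'))"

text \<open>On a complete space the set \<open>K\<close> below exists and is unique (Hutchinson).\<close>

definition ifs_invariant_set ::
    "nat \<Rightarrow> (nat \<Rightarrow> 'a::metric_space \<Rightarrow> 'a) \<Rightarrow> 'a set \<Rightarrow> bool" where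
  "ifs_invariant_set N F K \<longleftrightarrow>
     compact K \<and> K \<noteq> {} \<and> K = (\<Union>i\<in>{1..N}. F i ` K)"

text \<open>The first letter of a word acts first:
  \<open>F\<^sub>\<omega> = F\<^bsub>\<omega>\<^sub>n\<^esub> \<circ> \<dots> \<circ> F\<^bsub>\<omega>\<^sub>1\<^esub>\<close>.\<close>

definition word_map :: "(nat \<Rightarrow> 'a \<Rightarrow> 'a) \<Rightarrow> nat list \<Rightarrow> 'a \<Rightarrow> 'a" where
  "word_map F \<omega> = fold F \<omega>"

definition word_map_inv :: "(nat \<Rightarrow> 'a \<Rightarrow> 'a) \<Rightarrow> nat list \<Rightarrow> 'a \<Rightarrow> 'a" where
  "word_map_inv F \<omega> = foldr (\<lambda>i. inv (F i)) \<omega>"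


section \<open>The full one-sided shift\<close>

text \<open>The space of sequences is \<open>streams {1..N}\<close> and the shift is \<open>stl\<close>; the
  prefix \<open>x(k)\<close> is \<open>stake k x\<close>.\<close>

definition words :: "nat \<Rightarrow> nat \<Rightarrow> nat list set" where
  "words N n = {\<omega>. length \<omega> = n \<and> set \<omega> \<subseteq> {1..N}}"

definition cylinder :: "nat \<Rightarrow> nat list \<Rightarrow> nat stream set" where
  "cylinder N \<omega> = {x \<in> streams {1..N}. stake (length \<omega>) x = \<omega>}"

definition shift_space :: "nat \<Rightarrow> nat stream topology" where
  "shift_space N = topology_generated_by {cylinder N \<omega> | \<omega>. \<omega> \<in> (\<Union>n. words N n)}"


lemma topspace_shift_space: "topspace (shift_space N) = streams {1..N}"
proof -
  have "cylinder N [] = streams {1..N}" "[] \<in> (\<Union>n. words N n)"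
    by (auto simp: cylinder_def words_def)
  then have "streams {1..N} \<subseteq> topspace (shift_space N)"
    unfolding shift_space_def topology_generated_by_topspace by blast
  then show ?thesis
    unfolding shift_space_def topology_generated_by_topspace by (auto simp: cylinder_def)
qed


section \<open>The fractafold bundle\<close>

definition inductive_limit_topology :: "(nat \<Rightarrow> 'b topology) \<Rightarrow> 'b topology" where
  "inductive_limit_topology Y =
     topology (\<lambda>U. U \<subseteq> (\<Union>n. topspace (Y n)) \<and>
                   (\<forall>n. openin (Y n) (U \<inter> topspace (Y n))))"

lemma openin_inductive_limit_topology:
  "openin (inductive_limit_topology Y) U \<longleftrightarrow>
     U \<subseteq> (\<Union>n. topspace (Y n)) \<and> (\<forall>n. openin (Y n) (U \<inter> topspace (Y n)))"
proof -
  have "istopology (\<lambda>U. U \<subseteq> (\<Union>n. topspace (Y n)) \<and>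
                        (\<forall>n. openin (Y n) (U \<inter> topspace (Y n))))"
    unfolding istopology_def
  proof (intro conjI allI impI)
    fix S T n
    assume "S \<subseteq> (\<Union>n. topspace (Y n)) \<and> (\<forall>n. openin (Y n) (S \<inter> topspace (Y n)))"
      and "T \<subseteq> (\<Union>n. topspace (Y n)) \<and> (\<forall>n. openin (Y n) (T \<inter> topspace (Y n)))"
    then have "openin (Y n) (S \<inter> topspace (Y n))" "openin (Y n) (T \<inter> topspace (Y n))"
      by blast+
    then have "openin (Y n) ((S \<inter> topspace (Y n)) \<inter> (T \<inter> topspace (Y n)))"
      by (rule openin_Int)
    moreover have "(S \<inter> topspace (Y n)) \<inter> (T \<inter> topspace (Y n)) = S \<inter> T \<inter> topspace (Y n)"
      by blast
    ultimately show "openin (Y n) (S \<inter> T \<inter> topspace (Y n))"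
      by simp
  next
    fix \<K> n
    assume "\<forall>U\<in>\<K>. U \<subseteq> (\<Union>n. topspace (Y n)) \<and> (\<forall>n. openin (Y n) (U \<inter> topspace (Y n)))"
    then have "openin (Y n) (\<Union>U\<in>\<K>. U \<inter> topspace (Y n))"
      by (intro openin_Union) auto
    moreover have "(\<Union>U\<in>\<K>. U \<inter> topspace (Y n)) = \<Union>\<K> \<inter> topspace (Y n)"
      by blast
    ultimately show "openin (Y n) (\<Union>\<K> \<inter> topspace (Y n))"
      by simp
  qed auto
  then show ?thesis
    by (simp add: inductive_limit_topology_def topology_inverse')
qed

definition fractafold_level ::
    "nat \<Rightarrow> (nat \<Rightarrow> 'a::metric_space \<Rightarrow> 'a) \<Rightarrow> 'a set \<Rightarrow> nat \<Rightarrow> (nat stream \<times> 'a) set" where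
  "fractafold_level N F K n = (\<Union>\<omega>\<in>words N n. cylinder N \<omega> \<times> word_map_inv F \<omega> ` K)"

definition fractafold_level_space ::
    "nat \<Rightarrow> (nat \<Rightarrow> 'a::metric_space \<Rightarrow> 'a) \<Rightarrow> 'a set \<Rightarrow> nat \<Rightarrow> (nat stream \<times> 'a) topology" where
  "fractafold_level_space N F K n =
     subtopology (prod_topology (shift_space N) euclidean) (fractafold_level N F K n)"

definition fractafold_bundle ::
    "nat \<Rightarrow> (nat \<Rightarrow> 'a::metric_space \<Rightarrow> 'a) \<Rightarrow> 'a set \<Rightarrow> (nat stream \<times> 'a) topology" where
  "fractafold_bundle N F K = inductive_limit_topology (fractafold_level_space N F K)"


section \<open>Topological groupoids and their left actions\<close>

text \<open>The unit space is carried as a space of its own, and \<open>unit_at\<close> is its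
  identification with the units among the arrows. A product \<open>g h\<close> is meaningful
  when \<open>src g = rng h\<close>.\<close>

record ('g, 'x) groupoid_data =
  arrow_space :: "'g topology"
  unit_space :: "'x topology"
  rng :: "'g \<Rightarrow> 'x"
  src :: "'g \<Rightarrow> 'x"
  unit_at :: "'x \<Rightarrow> 'g"
  gmult :: "'g \<Rightarrow> 'g \<Rightarrow> 'g"
  ginv :: "'g \<Rightarrow> 'g"

definition composable_space :: "('g, 'x) groupoid_data \<Rightarrow> ('g \<times> 'g) topology" where
  "composable_space G =
     subtopology (prod_topology (arrow_space G) (arrow_space G)) {(g, h). src G g = rng G h}"

locale topological_groupoid =
  fixes G :: "('g, 'x) groupoid_data"
  assumes continuous_rng: "continuous_map (arrow_space G) (unit_space G) (rng G)"
    and continuous_src: "continuous_map (arrow_space G) (unit_space G) (src G)"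
    and continuous_unit: "continuous_map (unit_space G) (arrow_space G) (unit_at G)"
    and continuous_mult:
      "continuous_map (composable_space G) (arrow_space G) (\<lambda>(g, h). gmult G g h)"
    and continuous_inv: "continuous_map (arrow_space G) (arrow_space G) (ginv G)"
    and rng_unit: "x \<in> topspace (unit_space G) \<Longrightarrow> rng G (unit_at G x) = x"
    and src_unit: "x \<in> topspace (unit_space G) \<Longrightarrow> src G (unit_at G x) = x"
    and rng_mult: "(g, h) \<in> topspace (composable_space G) \<Longrightarrow> rng G (gmult G g h) = rng G g"
    and src_mult: "(g, h) \<in> topspace (composable_space G) \<Longrightarrow> src G (gmult G g h) = src G h"
    and mult_assoc:
      "\<lbrakk>(g, h) \<in> topspace (composable_space G); (h, k) \<in> topspace (composable_space G)\<rbrakk>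
       \<Longrightarrow> gmult G (gmult G g h) k = gmult G g (gmult G h k)"
    and unit_mult: "g \<in> topspace (arrow_space G) \<Longrightarrow> gmult G (unit_at G (rng G g)) g = g"
    and mult_unit: "g \<in> topspace (arrow_space G) \<Longrightarrow> gmult G g (unit_at G (src G g)) = g"
    and rng_inv: "g \<in> topspace (arrow_space G) \<Longrightarrow> rng G (ginv G g) = src G g"
    and src_inv: "g \<in> topspace (arrow_space G) \<Longrightarrow> src G (ginv G g) = rng G g"
    and mult_inv: "g \<in> topspace (arrow_space G) \<Longrightarrow> gmult G g (ginv G g) = unit_at G (rng G g)"
    and inv_mult: "g \<in> topspace (arrow_space G) \<Longrightarrow> gmult G (ginv G g) g = unit_at G (src G g)"

text \<open>The space \<open>G * Z\<close>.\<close>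

definition action_domain ::
    "('g, 'x) groupoid_data \<Rightarrow> 'z topology \<Rightarrow> ('z \<Rightarrow> 'x) \<Rightarrow> ('g \<times> 'z) topology" where
  "action_domain G Z \<rho> =
     subtopology (prod_topology (arrow_space G) Z) {(g, z). src G g = \<rho> z}"

locale left_action = topological_groupoid G
  for G :: "('g, 'x) groupoid_data" +
  fixes Z :: "'z topology" and \<rho> :: "'z \<Rightarrow> 'x" and act :: "'g \<Rightarrow> 'z \<Rightarrow> 'z"
  assumes continuous_anchor: "continuous_map Z (unit_space G) \<rho>"
    and open_anchor: "open_map Z (unit_space G) \<rho>"
    and continuous_act: "continuous_map (action_domain G Z \<rho>) Z (\<lambda>(g, z). act g z)"
    and anchor_act: "(g, z) \<in> topspace (action_domain G Z \<rho>) \<Longrightarrow> \<rho> (act g z) = rng G g"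
    and act_act:
      "\<lbrakk>(h, g) \<in> topspace (composable_space G); (g, z) \<in> topspace (action_domain G Z \<rho>)\<rbrakk>
       \<Longrightarrow> act h (act g z) = act (gmult G h g) z"
    and act_unit: "z \<in> topspace Z \<Longrightarrow> act (unit_at G (\<rho> z)) z = z"


section \<open>The Renault--Deaconu groupoid\<close>

definition rd_arrows :: "'x set \<Rightarrow> ('x \<Rightarrow> 'x) \<Rightarrow> ('x \<times> int \<times> 'x) set" where
  "rd_arrows X \<sigma> =
     {(x, int m - int n, y) | x y m n. x \<in> X \<and> y \<in> X \<and> (\<sigma> ^^ m) x = (\<sigma> ^^ n) y}"

text \<open>For a local homeomorphism \<open>\<sigma>\<close> the generating sets are already a basis, and
  they cover \<open>rd_arrows\<close>.\<close>

definition rd_arrow_space ::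
    "'x topology \<Rightarrow> ('x \<Rightarrow> 'x) \<Rightarrow> ('x \<times> int \<times> 'x) topology" where
  "rd_arrow_space X \<sigma> = topology_generated_by
     {{(x, int m - int n, y) | x y. (\<sigma> ^^ m) x = (\<sigma> ^^ n) y \<and> x \<in> U \<and> y \<in> V} | m n U V.
        openin X U \<and> openin X V \<and> inj_on (\<sigma> ^^ m) U \<and> inj_on (\<sigma> ^^ n) V \<and>
        (\<sigma> ^^ m) ` U = (\<sigma> ^^ n) ` V}"

lemma topspace_rd_arrow_space_shift:
  "topspace (rd_arrow_space (shift_space N) stl) = rd_arrows (streams {1..N}) stl"
proof (intro subset_antisym subsetI)
  fix g
  assume "g \<in> topspace (rd_arrow_space (shift_space N) stl)"
  then obtain m n U V where
    "openin (shift_space N) U" "openin (shift_space N) V"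
    "g \<in> {(x, int m - int n, y) | x y. (stl ^^ m) x = (stl ^^ n) y \<and> x \<in> U \<and> y \<in> V}"
    unfolding rd_arrow_space_def topology_generated_by_topspace by auto
  moreover from this have "U \<subseteq> streams {1..N}" "V \<subseteq> streams {1..N}"
    using openin_subset topspace_shift_space by metis+
  ultimately show "g \<in> rd_arrows (streams {1..N}) stl"
    unfolding rd_arrows_def by blast
next
  have stl_pow: "(stl ^^ m) z = sdrop m z" for m and z :: "nat stream"
    by (induction m arbitrary: z) (simp_all add: funpow_Suc_right del: funpow.simps(2))
  have pre: "stake m x \<in> words N m" if "x \<in> streams {1..N}" for m x
    using that stake_sdrop[of m x] sset_shift[of "stake m x" "sdrop m x"]
    by (auto simp: words_def streams_iff_sset)
  have op: "openin (shift_space N) (cylinder N (stake m x))" if "x \<in> streams {1..N}" for m x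
    unfolding shift_space_def using pre[OF that] by (intro topology_generated_by_Basis) blast
  have inj: "inj_on (stl ^^ m) (cylinder N (stake m x))" for m x
  proof (rule inj_onI)
    fix z w
    assume "z \<in> cylinder N (stake m x)" "w \<in> cylinder N (stake m x)"
      "(stl ^^ m) z = (stl ^^ m) w"
    then have "stake m z = stake m w" "sdrop m z = sdrop m w"
      by (simp_all add: cylinder_def stl_pow)
    then show "z = w"
      by (metis stake_sdrop)
  qed
  have im: "(stl ^^ m) ` cylinder N (stake m x) = streams {1..N}" if "x \<in> streams {1..N}" for m x
  proof (intro subset_antisym subsetI)
    fix z assume "z \<in> (stl ^^ m) ` cylinder N (stake m x)"
    then obtain w where "w \<in> streams {1..N}" "z = sdrop m w"
      by (auto simp: stl_pow cylinder_def)
    then show "z \<in> streams {1..N}"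
      by (simp add: streams_iff_snth sdrop_snth)
  next
    fix z assume "z \<in> streams {1..N}"
    then have "stake m x @- z \<in> cylinder N (stake m x)"
      using pre[OF that, of m] by (auto simp: cylinder_def streams_iff_sset words_def stake_shift)
    moreover have "(stl ^^ m) (stake m x @- z) = z"
      by (simp add: stl_pow sdrop_shift)
    ultimately show "z \<in> (stl ^^ m) ` cylinder N (stake m x)"
      by (metis imageI)
  qed
  fix g
  assume "g \<in> rd_arrows (streams {1..N}) stl"
  then obtain m n x y where g: "x \<in> streams {1..N}" "y \<in> streams {1..N}"
    "(stl ^^ m) x = (stl ^^ n) y" "g = (x, int m - int n, y)"
    by (auto simp: rd_arrows_def)
  let ?U = "cylinder N (stake m x)" and ?V = "cylinder N (stake n y)"
  let ?B = "{(x, int m - int n, y) | x y. (stl ^^ m) x = (stl ^^ n) y \<and> x \<in> ?U \<and> y \<in> ?V}"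
  have "openin (rd_arrow_space (shift_space N) stl) ?B"
    unfolding rd_arrow_space_def
    using op g(1,2) inj im
    by (intro topology_generated_by_Basis CollectI exI[of _ m] exI[of _ n] exI[of _ ?U]
        exI[of _ ?V] conjI refl) simp_all
  moreover have "g \<in> ?B"
    using g by (auto simp: cylinder_def)
  ultimately show "g \<in> topspace (rd_arrow_space (shift_space N) stl)"
    using openin_subset by blast
qed

definition rd_groupoid ::
    "'x topology \<Rightarrow> ('x \<Rightarrow> 'x) \<Rightarrow> ('x \<times> int \<times> 'x, 'x) groupoid_data" where
  "rd_groupoid X \<sigma> =
     \<lparr>arrow_space = rd_arrow_space X \<sigma>,
      unit_space = X,
      rng = (\<lambda>(x, k, y). x),
      src = (\<lambda>(x, k, y). y),
      unit_at = (\<lambda>x. (x, 0, x)),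
      gmult = (\<lambda>(x, k, y) (y', l, w). (x, k + l, w)),
      ginv = (\<lambda>(x, k, y). (y, - k, x))\<rparr>"

end

theory Submission
  imports Defs
begin

text \<open>The arrows \<open>(\<alpha>z, \<bar>\<alpha>\<bar> - \<bar>\<beta>\<bar>, \<beta>z)\<close> with fixed words \<open>\<alpha>\<close>, \<open>\<beta>\<close> and arbitrary \<open>z\<close>
  form an open set on which the action is
  \<open>(\<beta>z, t) \<mapsto> (\<alpha>z, F\<^sub>\<alpha>\<inverse> (F\<^sub>\<beta> t))\<close>. For \<open>j \<ge> \<bar>\<beta>\<bar>\<close> this map carries the part of the
  \<open>j\<close>-th level of the bundle over \<open>Z(\<beta>)\<close> onto the part of level \<open>\<bar>\<alpha>\<bar> + j - \<bar>\<beta>\<bar>\<close> over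
  \<open>Z(\<alpha>)\<close>, so it is continuous for the inductive limit topology; its inverse is the same
  map with \<open>\<alpha>\<close> and \<open>\<beta>\<close> exchanged. Since these arrow sets form a basis of the groupoid,
  the action is both continuous and open.\<close>

section \<open>The shift space\<close>

lemma stl_funpow: "(stl ^^ m) x = sdrop m x"
  by (induction m arbitrary: x) (simp_all add: funpow_Suc_right del: funpow.simps(2))

lemma stream_eqI: "stake m x = stake m y \<Longrightarrow> sdrop m x = sdrop m y \<Longrightarrow> x = y"
  by (metis stake_sdrop)

lemma stake_eq_mono: "stake m x = stake m y \<Longrightarrow> k \<le> m \<Longrightarrow> stake k x = stake k y"
  by (metis min.absorb1 take_stake)

lemma sdrop_eq_mono: "sdrop m x = sdrop n y \<Longrightarrow> sdrop (m + j) x = sdrop (n + j) y"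
  by (metis sdrop_add)

lemma shift_in_streams: "\<alpha> @- z \<in> streams A \<longleftrightarrow> set \<alpha> \<subseteq> A \<and> z \<in> streams A"
  by (auto simp: streams_iff_sset)

lemma set_stake_subset: "x \<in> streams A \<Longrightarrow> set (stake n x) \<subseteq> A"
  by (metis shift_in_streams stake_sdrop)

lemma sdrop_in_streams: "x \<in> streams A \<Longrightarrow> sdrop n x \<in> streams A"
  by (metis shift_in_streams stake_sdrop)

lemma in_cylinder_stake [simp]: "x \<in> cylinder N (stake m x) \<longleftrightarrow> x \<in> streams {1..N}"
  by (auto simp: cylinder_def)

lemma openin_cylinder:
  assumes "set \<alpha> \<subseteq> {1..N}"
  shows "openin (shift_space N) (cylinder N \<alpha>)"
  unfolding shift_space_def
  by (rule topology_generated_by_Basis) (use assms in \<open>auto simp: words_def\<close>)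

text \<open>Induction on the generated topology. All sufficiently long prefixes are asked for, not
  one: finite intersections then only need a maximum, and the length can later be matched to other
  constraints.\<close>

lemma shift_space_local_base:
  assumes "openin (shift_space N) U" "x \<in> U"
  shows "\<exists>p. \<forall>m\<ge>p. cylinder N (stake m x) \<subseteq> U"
proof -
  have "generate_topology_on {cylinder N \<omega> | \<omega>. \<omega> \<in> (\<Union>n. words N n)} U"
    using assms(1) by (simp add: shift_space_def openin_topology_generated_by_iff)
  then show ?thesis
    using assms(2)
  proof (induction rule: generate_topology_on.induct)
    case (Int a b)
    then obtain p q where "\<forall>m\<ge>p. cylinder N (stake m x) \<subseteq> a" "\<forall>m\<ge>q. cylinder N (stake m x) \<subseteq> b"
      by blast
    then show ?case
      by (intro exI[of _ "max p q"]) auto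
  next
    case (UN \<K>)
    then show ?case
      by (meson Union_upper UnionE order_trans)
  next
    case (Basis s)
    then obtain \<omega> where \<omega>: "s = cylinder N \<omega>" by blast
    \<comment> \<open>Since \<open>x\<close> lies in Z(\<omega>), every prefix of \<open>x\<close>
      of length at least that of \<omega> extends \<omega>.\<close>
    have "cylinder N (stake m x) \<subseteq> s" if "length \<omega> \<le> m" for m
    proof
      fix w assume "w \<in> cylinder N (stake m x)"
      then have "w \<in> streams {1..N}" "stake m w = stake m x"
        by (auto simp: cylinder_def)
      moreover have "stake (length \<omega>) x = \<omega>"
        using Basis(2) by (simp add: \<omega> cylinder_def)
      ultimately show "w \<in> s"
        using stake_eq_mono[OF _ that, of w x] by (simp add: \<omega> cylinder_def)
    qed
    then show ?case by blast
  qed simp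
qed

section \<open>Continuity by neighbourhoods, and replacement of a prefix\<close>

lemma continuous_map_pointwiseI:
  assumes "\<And>x. x \<in> topspace X \<Longrightarrow> f x \<in> topspace Y"
    and "\<And>x V. \<lbrakk>x \<in> topspace X; openin Y V; f x \<in> V\<rbrakk> \<Longrightarrow> \<exists>U. openin X U \<and> x \<in> U \<and> f ` U \<subseteq> V"
  shows "continuous_map X Y f"
  unfolding continuous_map_eq_topcontinuous_at topcontinuous_at_def
proof (intro ballI conjI allI impI)
  fix x V assume "x \<in> topspace X" "openin Y V \<and> f x \<in> V"
  then obtain U where "openin X U" "x \<in> U" "f ` U \<subseteq> V"
    using assms(2) by blast
  then show "\<exists>U. openin X U \<and> x \<in> U \<and> (\<forall>y\<in>U. f y \<in> V)"
    by blast
qed (use assms(1) in auto)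

lemma continuous_map_replace_prefix:
  assumes "set \<alpha> \<subseteq> {1..N}"
  shows "continuous_map (shift_space N) (shift_space N) (\<lambda>y. \<alpha> @- sdrop n y)"
proof (rule continuous_map_pointwiseI)
  fix y assume "y \<in> topspace (shift_space N)"
  then have y: "y \<in> streams {1..N}" by (simp add: topspace_shift_space)
  then show "\<alpha> @- sdrop n y \<in> topspace (shift_space N)"
    using assms by (simp add: topspace_shift_space shift_in_streams sdrop_in_streams)
  fix V assume "openin (shift_space N) V" "\<alpha> @- sdrop n y \<in> V"
  then obtain p where p: "\<forall>m\<ge>p. cylinder N (stake m (\<alpha> @- sdrop n y)) \<subseteq> V"
    using shift_space_local_base by blast
  \<comment> \<open>Dropping \<open>n\<close> letters leaves \<open>p\<close> prescribed ones; with
    \<alpha> in front, the image is prescribed on \<open>length \<alpha> + p\<close> letters, hence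
    on at least \<open>p\<close>.\<close>
  let ?U = "cylinder N (stake (n + p) y)"
  have "(\<lambda>y. \<alpha> @- sdrop n y) ` ?U \<subseteq> V"
  proof clarify
    fix w assume "w \<in> ?U"
    then have w: "w \<in> streams {1..N}" "stake (n + p) w = stake (n + p) y"
      by (auto simp: cylinder_def)
    then have "stake p (sdrop n w) = stake p (sdrop n y)"
      by (metis diff_add_inverse drop_stake)
    then have "\<alpha> @- sdrop n w \<in> cylinder N (stake (length \<alpha> + p) (\<alpha> @- sdrop n y))"
      using w assms
      by (simp add: cylinder_def shift_in_streams sdrop_in_streams stake_shift sdrop_shift
          flip: stake_add)
    then show "\<alpha> @- sdrop n w \<in> V" using p by (meson le_add2 subsetD)
  qed
  then show "\<exists>U. openin (shift_space N) U \<and> y \<in> U \<and> (\<lambda>y. \<alpha> @- sdrop n y) ` U \<subseteq> V"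
    using y openin_cylinder[OF set_stake_subset[OF y]] by (intro exI[of _ ?U]) auto
qed


section \<open>The groupoid of the shift\<close>

text \<open>For \<open>x\<close> and \<open>y\<close> in the sequence space, with \<alpha> = x(m)
  and \<beta> = y(n), these are the arrows (\<alpha>z, m - n, \<beta>z). The sequences serve only to
  supply the two prefixes; they need not themselves be joined by an arrow.\<close>

definition arrow_cylinder ::
    "nat \<Rightarrow> nat \<Rightarrow> nat \<Rightarrow> nat stream \<Rightarrow> nat stream \<Rightarrow> (nat stream \<times> int \<times> nat stream) set" where
  "arrow_cylinder N m n x y =
     {(x', int m - int n, y') | x' y'. sdrop m x' = sdrop n y' \<and>
        x' \<in> cylinder N (stake m x) \<and> y' \<in> cylinder N (stake n y)}"

lemma mem_arrow_cylinder:
  "(x', k, y') \<in> arrow_cylinder N m n x y \<longleftrightarrow>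
     k = int m - int n \<and> sdrop m x' = sdrop n y' \<and> x' \<in> streams {1..N} \<and> y' \<in> streams {1..N} \<and>
     stake m x' = stake m x \<and> stake n y' = stake n y"
  by (auto simp: arrow_cylinder_def cylinder_def)

lemma mem_rd_arrows_stl:
  "(x, k, y) \<in> rd_arrows X stl \<longleftrightarrow>
     x \<in> X \<and> y \<in> X \<and> (\<exists>m n. k = int m - int n \<and> sdrop m x = sdrop n y)"
  by (auto simp: rd_arrows_def stl_funpow)

text \<open>The m-fold shift maps a cylinder of length \<open>m\<close> bijectively onto the whole
  sequence space, so the two cylinders have equal images, as a generating set of the topology
  demands.\<close>

lemma openin_arrow_cylinder:
  assumes "x \<in> streams {1..N}" "y \<in> streams {1..N}"
  shows "openin (rd_arrow_space (shift_space N) stl) (arrow_cylinder N m n x y)"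
proof -
  have inj: "inj_on (sdrop m) (cylinder N (stake m x))" for m x
    by (rule inj_onI) (auto simp: cylinder_def intro: stream_eqI[of m])
  have im: "sdrop m ` cylinder N (stake m x) = streams {1..N}" if "x \<in> streams {1..N}" for m x
  proof (intro subset_antisym subsetI)
    fix z assume z: "z \<in> streams {1..N}"
    then have "stake m x @- z \<in> cylinder N (stake m x)"
      using that by (simp add: cylinder_def shift_in_streams set_stake_subset stake_shift)
    moreover have "sdrop m (stake m x @- z) = z"
      by (simp add: sdrop_shift)
    ultimately show "z \<in> sdrop m ` cylinder N (stake m x)"
      by (metis imageI)
  qed (auto simp: cylinder_def sdrop_in_streams)
  have stl_pow: "stl ^^ m = sdrop m" for m
    by (rule ext) (rule stl_funpow)
  show ?thesis
    unfolding rd_arrow_space_def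
    by (rule topology_generated_by_Basis, rule CollectI, rule exI[of _ m], rule exI[of _ n],
        rule exI[of _ "cylinder N (stake m x)"], rule exI[of _ "cylinder N (stake n y)"])
      (simp add: stl_pow arrow_cylinder_def inj im[OF assms(1)] im[OF assms(2)]
        openin_cylinder[OF set_stake_subset[OF assms(1)]] openin_cylinder[OF set_stake_subset[OF assms(2)]])
qed

text \<open>All large pairs with difference \<open>k\<close> are covered, so that intersections only
  need a maximum and \<open>m\<close>, \<open>n\<close> can be fitted to further requirements later.
  The equation of tails belongs to the conclusion because a pair with the right difference may be
  too short to satisfy it.\<close>

lemma rd_arrow_space_local_base:
  assumes "openin (rd_arrow_space (shift_space N) stl) W" "(x, k, y) \<in> W"
  shows "\<exists>p. \<forall>m n. p \<le> m \<longrightarrow> p \<le> n \<longrightarrow> k = int m - int n \<longrightarrow>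
           sdrop m x = sdrop n y \<and> arrow_cylinder N m n x y \<subseteq> W"
proof -
  let ?B = "{{(x, int m - int n, y) | x y. (stl ^^ m) x = (stl ^^ n) y \<and> x \<in> U \<and> y \<in> V} | m n U V.
        openin (shift_space N) U \<and> openin (shift_space N) V \<and> inj_on (stl ^^ m) U \<and>
        inj_on (stl ^^ n) V \<and> (stl ^^ m) ` U = (stl ^^ n) ` V}"
  have "generate_topology_on ?B W"
    using assms(1) by (simp add: rd_arrow_space_def openin_topology_generated_by_iff)
  then show ?thesis
    using assms(2)
  proof (induction rule: generate_topology_on.induct)
    case (Int a b)
    then obtain p q where
      "\<forall>m n. p \<le> m \<longrightarrow> p \<le> n \<longrightarrow> k = int m - int n \<longrightarrow>
         sdrop m x = sdrop n y \<and> arrow_cylinder N m n x y \<subseteq> a"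
      "\<forall>m n. q \<le> m \<longrightarrow> q \<le> n \<longrightarrow> k = int m - int n \<longrightarrow>
         sdrop m x = sdrop n y \<and> arrow_cylinder N m n x y \<subseteq> b"
      by blast
    then show ?case
      by (intro exI[of _ "max p q"]) auto
  next
    case (UN \<K>)
    then show ?case
      by (meson Union_upper UnionE order_trans)
  next
    case (Basis s)
    then obtain m0 n0 U V where
      s: "s = {(x, int m0 - int n0, y) | x y. (stl ^^ m0) x = (stl ^^ n0) y \<and> x \<in> U \<and> y \<in> V}"
      and UV: "openin (shift_space N) U" "openin (shift_space N) V"
      by blast
    have xy: "k = int m0 - int n0" "sdrop m0 x = sdrop n0 y" "x \<in> U" "y \<in> V"
      using Basis(2) by (auto simp: s stl_funpow)
    obtain a b where a: "\<forall>m\<ge>a. cylinder N (stake m x) \<subseteq> U" and b: "\<forall>m\<ge>b. cylinder N (stake m y) \<subseteq> V"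
      using shift_space_local_base UV xy by meson
    \<comment> \<open>The bound gives m \<ge> m0 and n \<ge> n0, so both pairs differ by a common
      shift \<open>j\<close>, and also m \<ge> a and n \<ge> b, which puts the cylinders inside
      \<open>U\<close> and \<open>V\<close>.\<close>
    have "sdrop m x = sdrop n y \<and> arrow_cylinder N m n x y \<subseteq> s"
      if mn: "m0 + n0 + a + b \<le> m" "m0 + n0 + a + b \<le> n" "k = int m - int n" for m n
    proof -
      obtain j where j: "m = m0 + j" "n = n0 + j"
        using mn xy(1) by (intro that[of "m - m0"]) auto
      have "(x', l, y') \<in> s" if g: "(x', l, y') \<in> arrow_cylinder N m n x y" for x' l y'
      proof -
        have g': "l = int m - int n" "sdrop m x' = sdrop n y'" "stake m x' = stake m x"
          "stake n y' = stake n y" "x' \<in> streams {1..N}" "y' \<in> streams {1..N}"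
          using g by (auto simp: mem_arrow_cylinder)
        \<comment> \<open>The new arrow has equal tails only after \<open>m\<close> and
          \<open>n\<close> letters, whereas \<open>s\<close> needs this after \<open>m0\<close> and
          \<open>n0\<close>. The \<open>j\<close> letters in between are copied from
          \<open>x\<close> and \<open>y\<close>, where they agree.\<close>
        have "stake j (sdrop m0 x') = stake j (sdrop m0 x)"
          using g'(3) j by (metis diff_add_inverse drop_stake)
        moreover have "stake j (sdrop n0 y') = stake j (sdrop n0 y)"
          using g'(4) j by (metis diff_add_inverse drop_stake)
        ultimately have "stake j (sdrop m0 x') = stake j (sdrop n0 y')"
          by (simp only: xy(2))
        moreover have "sdrop j (sdrop m0 x') = sdrop j (sdrop n0 y')"
          using g'(2) unfolding j sdrop_add .
        ultimately have "sdrop m0 x' = sdrop n0 y'"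
          by (rule stream_eqI)
        moreover have "x' \<in> U" "y' \<in> V"
          using a[rule_format, of m] b[rule_format, of n] mn(1,2) g' by (auto simp: cylinder_def)
        ultimately show ?thesis
          using g'(1) j by (auto simp: s stl_funpow)
      qed
      then show ?thesis
        using sdrop_eq_mono[OF xy(2), of j] j by auto
    qed
    then show ?case by blast
  qed simp
qed

lemma int_diff_representatives:
  obtains m n where "p \<le> m" "p \<le> n" "k = int m - int n"
proof
  show "p \<le> nat k + p" "p \<le> nat (- k) + p" "k = int (nat k + p) - int (nat (- k) + p)"
    by auto
qed

section \<open>Groupoid laws and continuity of the structure maps\<close>

lemma rd_groupoid_sel [simp]:
  "arrow_space (rd_groupoid X \<sigma>) = rd_arrow_space X \<sigma>"
  "unit_space (rd_groupoid X \<sigma>) = X"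
  "rng (rd_groupoid X \<sigma>) (x, k, y) = x"
  "src (rd_groupoid X \<sigma>) (x, k, y) = y"
  "unit_at (rd_groupoid X \<sigma>) x = (x, 0, x)"
  "gmult (rd_groupoid X \<sigma>) (x, k, y) (y', l, w) = (x, k + l, w)"
  "ginv (rd_groupoid X \<sigma>) (x, k, y) = (y, - k, x)"
  by (simp_all add: rd_groupoid_def)

lemma mult_in_rd_arrows:
  assumes "(x, k, y) \<in> rd_arrows X stl" "(y, l, w) \<in> rd_arrows X stl"
  shows "(x, k + l, w) \<in> rd_arrows X stl"
proof -
  obtain m n a b where *: "k = int m - int n" "sdrop m x = sdrop n y"
    "l = int a - int b" "sdrop a y = sdrop b w"
    using assms by (auto simp: mem_rd_arrows_stl)
  \<comment> \<open>Both representations are lengthened until they meet in the same tail of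
    \<open>y\<close>, the one after \<open>n + a\<close> letters.\<close>
  have "sdrop (m + a) x = sdrop (b + n) w"
    using sdrop_eq_mono[OF *(2), of a] sdrop_eq_mono[OF *(4), of n] by (simp add: add.commute)
  moreover have "k + l = int (m + a) - int (b + n)" using * by simp
  ultimately show ?thesis
    using assms unfolding mem_rd_arrows_stl by blast
qed

lemma inv_in_rd_arrows: "(x, k, y) \<in> rd_arrows X stl \<Longrightarrow> (y, - k, x) \<in> rd_arrows X stl"
  unfolding mem_rd_arrows_stl by (metis minus_diff_eq)

lemma topological_groupoid_shift: "topological_groupoid (rd_groupoid (shift_space N) stl)"
proof -
  let ?A = "rd_arrow_space (shift_space N) stl" and ?G = "rd_groupoid (shift_space N) stl"
  let ?X = "streams {1..N}"
  note tops = topspace_rd_arrow_space_shift topspace_shift_space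
  have arr: "x \<in> ?X" "y \<in> ?X" if "(x, k, y) \<in> rd_arrows ?X stl" for x k y
    using that by (auto simp: mem_rd_arrows_stl)
  have nbhd: "openin ?A (arrow_cylinder N m n x y)"
    if "(x, k, y) \<in> rd_arrows ?X stl" for m n x k y
    using that openin_arrow_cylinder arr by metis
  have repr: "\<exists>p. \<forall>m n. p \<le> m \<longrightarrow> p \<le> n \<longrightarrow> k = int m - int n \<longrightarrow> (x, k, y) \<in> arrow_cylinder N m n x y"
    if "(x, k, y) \<in> rd_arrows ?X stl" for x k y
  proof -
    \<comment> \<open>Only the equation of tails for large pairs is wanted here, so the whole space
      serves as the open set.\<close>
    have "(x, k, y) \<in> topspace ?A" using that by (simp add: tops)
    from rd_arrow_space_local_base[OF openin_topspace this] obtain p where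
      "\<forall>m n. p \<le> m \<longrightarrow> p \<le> n \<longrightarrow> k = int m - int n \<longrightarrow> sdrop m x = sdrop n y"
      by blast
    then show ?thesis
      using arr[OF that] by (intro exI[of _ p]) (simp add: mem_arrow_cylinder)
  qed
  have comp: "(g, h) \<in> topspace (composable_space ?G) \<longleftrightarrow>
      g \<in> rd_arrows ?X stl \<and> h \<in> rd_arrows ?X stl \<and> src ?G g = rng ?G h" for g h
    by (auto simp: composable_space_def tops)
  show ?thesis
  proof
    show "continuous_map (arrow_space ?G) (unit_space ?G) (rng ?G)"
    proof (rule continuous_map_pointwiseI)
      fix g assume "g \<in> topspace (arrow_space ?G)"
      then obtain x k y where g: "g = (x, k, y)" "(x, k, y) \<in> rd_arrows ?X stl"
        by (cases g) (simp add: tops)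
      show "rng ?G g \<in> topspace (unit_space ?G)" using g arr by (simp add: tops)
      fix V assume "openin (unit_space ?G) V" "rng ?G g \<in> V"
      then obtain p where p: "\<forall>m\<ge>p. cylinder N (stake m x) \<subseteq> V"
        using shift_space_local_base[of N V x] g by auto
      obtain q where q: "\<forall>m n. q \<le> m \<longrightarrow> q \<le> n \<longrightarrow> k = int m - int n \<longrightarrow>
          (x, k, y) \<in> arrow_cylinder N m n x y"
        using repr g by blast
      obtain m n where mn: "max p q \<le> m" "max p q \<le> n" "k = int m - int n"
        using int_diff_representatives by blast
      have "rng ?G ` arrow_cylinder N m n x y \<subseteq> V"
        using p[rule_format, of m] mn by (auto simp: arrow_cylinder_def)
      then show "\<exists>U. openin (arrow_space ?G) U \<and> g \<in> U \<and> rng ?G ` U \<subseteq> V"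
        using q mn g nbhd by (intro exI[of _ "arrow_cylinder N m n x y"]) auto
    qed
    show "continuous_map (arrow_space ?G) (unit_space ?G) (src ?G)"
    proof (rule continuous_map_pointwiseI)
      fix g assume "g \<in> topspace (arrow_space ?G)"
      then obtain x k y where g: "g = (x, k, y)" "(x, k, y) \<in> rd_arrows ?X stl"
        by (cases g) (simp add: tops)
      show "src ?G g \<in> topspace (unit_space ?G)" using g arr by (simp add: tops)
      fix V assume "openin (unit_space ?G) V" "src ?G g \<in> V"
      then obtain p where p: "\<forall>m\<ge>p. cylinder N (stake m y) \<subseteq> V"
        using shift_space_local_base[of N V y] g by auto
      obtain q where q: "\<forall>m n. q \<le> m \<longrightarrow> q \<le> n \<longrightarrow> k = int m - int n \<longrightarrow>
          (x, k, y) \<in> arrow_cylinder N m n x y"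
        using repr g by blast
      obtain m n where mn: "max p q \<le> m" "max p q \<le> n" "k = int m - int n"
        using int_diff_representatives by blast
      have "src ?G ` arrow_cylinder N m n x y \<subseteq> V"
        using p[rule_format, of n] mn by (auto simp: arrow_cylinder_def)
      then show "\<exists>U. openin (arrow_space ?G) U \<and> g \<in> U \<and> src ?G ` U \<subseteq> V"
        using q mn g nbhd by (intro exI[of _ "arrow_cylinder N m n x y"]) auto
    qed
    show "continuous_map (unit_space ?G) (arrow_space ?G) (unit_at ?G)"
    proof (rule continuous_map_pointwiseI)
      fix x assume "x \<in> topspace (unit_space ?G)"
      then have x: "x \<in> ?X" by (simp add: tops)
      then show "unit_at ?G x \<in> topspace (arrow_space ?G)"
        by (auto simp: tops mem_rd_arrows_stl)
      fix V assume "openin (arrow_space ?G) V" "unit_at ?G x \<in> V"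
      then obtain p where p: "\<forall>m n. p \<le> m \<longrightarrow> p \<le> n \<longrightarrow> 0 = int m - int n \<longrightarrow>
          sdrop m x = sdrop n x \<and> arrow_cylinder N m n x x \<subseteq> V"
        using rd_arrow_space_local_base[of N V x 0 x] by auto
      \<comment> \<open>For a unit \<open>k = 0\<close>, so the pair m = n = p is
        admissible.\<close>
      have "unit_at ?G ` cylinder N (stake p x) \<subseteq> arrow_cylinder N p p x x"
        by (auto simp: mem_arrow_cylinder cylinder_def)
      then show "\<exists>U. openin (unit_space ?G) U \<and> x \<in> U \<and> unit_at ?G ` U \<subseteq> V"
        using p x openin_cylinder[OF set_stake_subset[OF x]]
        by (intro exI[of _ "cylinder N (stake p x)"]) fastforce
    qed
    show "continuous_map (arrow_space ?G) (arrow_space ?G) (ginv ?G)"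
    proof (rule continuous_map_pointwiseI)
      fix g assume "g \<in> topspace (arrow_space ?G)"
      then obtain x k y where g: "g = (x, k, y)" "(x, k, y) \<in> rd_arrows ?X stl"
        by (cases g) (simp add: tops)
      show "ginv ?G g \<in> topspace (arrow_space ?G)" using g inv_in_rd_arrows by (simp add: tops)
      fix V assume "openin (arrow_space ?G) V" "ginv ?G g \<in> V"
      then obtain p where p: "\<forall>m n. p \<le> m \<longrightarrow> p \<le> n \<longrightarrow> - k = int m - int n \<longrightarrow>
          sdrop m y = sdrop n x \<and> arrow_cylinder N m n y x \<subseteq> V"
        using rd_arrow_space_local_base[of N V y "- k" x] g by auto
      obtain m n where mn: "p \<le> m" "p \<le> n" "k = int m - int n"
        using int_diff_representatives by blast
      have "sdrop n y = sdrop m x" and sub: "arrow_cylinder N n m y x \<subseteq> V"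
        using p mn by auto
      then have "g \<in> arrow_cylinder N m n x y"
        using g arr mn by (simp add: mem_arrow_cylinder)
      moreover have "ginv ?G ` arrow_cylinder N m n x y \<subseteq> arrow_cylinder N n m y x"
        by (auto simp: mem_arrow_cylinder)
      ultimately show "\<exists>U. openin (arrow_space ?G) U \<and> g \<in> U \<and> ginv ?G ` U \<subseteq> V"
        using sub g nbhd by (intro exI[of _ "arrow_cylinder N m n x y"]) auto
    qed
    show "continuous_map (composable_space ?G) (arrow_space ?G) (\<lambda>(g, h). gmult ?G g h)"
    proof (rule continuous_map_pointwiseI)
      fix gh assume "gh \<in> topspace (composable_space ?G)"
      then obtain x k y l w where gh: "gh = ((x, k, y), (y, l, w))"
        "(x, k, y) \<in> rd_arrows ?X stl" "(y, l, w) \<in> rd_arrows ?X stl"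
        by (cases gh) (auto simp: comp)
      show "(\<lambda>(g, h). gmult ?G g h) gh \<in> topspace (arrow_space ?G)"
        using gh mult_in_rd_arrows by (simp add: tops)
      fix V assume "openin (arrow_space ?G) V" "(\<lambda>(g, h). gmult ?G g h) gh \<in> V"
      then obtain p where p: "\<forall>m n. p \<le> m \<longrightarrow> p \<le> n \<longrightarrow> k + l = int m - int n \<longrightarrow>
          sdrop m x = sdrop n w \<and> arrow_cylinder N m n x w \<subseteq> V"
        using rd_arrow_space_local_base[of N V x "k + l" w] gh by auto
      obtain q where q: "\<forall>m n. q \<le> m \<longrightarrow> q \<le> n \<longrightarrow> k = int m - int n \<longrightarrow>
          (x, k, y) \<in> arrow_cylinder N m n x y"
        using repr gh by blast
      obtain q' where q': "\<forall>m n. q' \<le> m \<longrightarrow> q' \<le> n \<longrightarrow> l = int m - int n \<longrightarrow>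
          (y, l, w) \<in> arrow_cylinder N m n y w"
        using repr gh by blast
      \<comment> \<open>The two factors must prescribe the same number \<open>a\<close> of letters
        of the middle sequence. Then \<open>n\<close> is forced to be a - l, and the margin |l|
        keeps it natural and above \<open>p\<close>, \<open>q\<close> and \<open>q'\<close>.\<close>
      obtain m a where ma: "p + q + q' + nat \<bar>l\<bar> \<le> m" "p + q + q' + nat \<bar>l\<bar> \<le> a" "k = int m - int a"
        using int_diff_representatives by blast
      define n where "n = nat (int a - l)"
      have n: "l = int a - int n" "p + q + q' \<le> n"
        using ma by (auto simp: n_def)
      have sub: "arrow_cylinder N m n x w \<subseteq> V"
        using p ma n by auto
      let ?U = "(arrow_cylinder N m a x y \<times> arrow_cylinder N a n y w) \<inter> {(g, h). src ?G g = rng ?G h}"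
      have "openin (composable_space ?G) ?U"
        unfolding composable_space_def
        by (intro openin_subtopology_Int) (use nbhd gh in \<open>auto simp: openin_prod_Times_iff\<close>)
      moreover have "gh \<in> ?U"
        using q[rule_format, of m a] q'[rule_format, of a n] ma n gh(1) by auto
      moreover have "(\<lambda>(g, h). gmult ?G g h) ` ?U \<subseteq> arrow_cylinder N m n x w"
        by (auto simp: mem_arrow_cylinder)
      ultimately show "\<exists>U. openin (composable_space ?G) U \<and> gh \<in> U \<and>
          (\<lambda>(g, h). gmult ?G g h) ` U \<subseteq> V"
        using sub by blast
    qed
  qed (auto simp: comp tops)
qed


section \<open>The fractafold bundle\<close>

lemma word_map_simps [simp]:
  "word_map F [] t = t"
  "word_map F (i # \<alpha>) t = word_map F \<alpha> (F i t)"
  "word_map_inv F [] t = t"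
  "word_map_inv F (i # \<alpha>) t = inv (F i) (word_map_inv F \<alpha> t)"
  by (simp_all add: word_map_def word_map_inv_def)

lemma word_map_append: "word_map F (\<alpha> @ \<beta>) t = word_map F \<beta> (word_map F \<alpha> t)"
  by (simp add: word_map_def)

lemma word_map_inv_append:
  "word_map_inv F (\<alpha> @ \<beta>) t = word_map_inv F \<alpha> (word_map_inv F \<beta> t)"
  by (simp add: word_map_inv_def)

text \<open>The action of all arrows (\<alpha>z, k, \<beta>z) at once. It is meaningful over
  Z(\<beta>) only, but dropping letters blindly makes it a total map, continuous on the whole
  product.\<close>

definition bundle_transfer ::
    "(nat \<Rightarrow> 'a \<Rightarrow> 'a) \<Rightarrow> nat list \<Rightarrow> nat list \<Rightarrow> nat stream \<times> 'a \<Rightarrow> nat stream \<times> 'a" where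
  "bundle_transfer F \<alpha> \<beta> =
     (\<lambda>(y, t). (\<alpha> @- sdrop (length \<beta>) y, word_map_inv F \<alpha> (word_map F \<beta> t)))"

text \<open>An arrow stores only the difference \<open>k\<close>, so a pair representing it has to
  be chosen; the result is shown below not to depend on the choice. The base point of the second
  argument is ignored, as it equals \<open>y\<close> on the domain of the action.\<close>

definition bundle_action ::
    "(nat \<Rightarrow> 'a \<Rightarrow> 'a) \<Rightarrow> nat stream \<times> int \<times> nat stream \<Rightarrow> nat stream \<times> 'a \<Rightarrow> nat stream \<times> 'a" where
  "bundle_action F = (\<lambda>(x, k, y) (_, t).
     let (m, n) = (SOME (m, n). k = int m - int n \<and> sdrop m x = sdrop n y)
     in (x, word_map_inv F (stake m x) (word_map F (stake n y) t)))"

locale surjective_ifs =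
  fixes N :: nat and F :: "nat \<Rightarrow> 'a::metric_space \<Rightarrow> 'a" and K :: "'a set"
  assumes nondegenerate: "nondegenerate_ifs N F"
    and surj: "i \<in> {1..N} \<Longrightarrow> surj (F i)"
    and invariant: "ifs_invariant_set N F K"
begin

abbreviation "X \<equiv> shift_space N"
abbreviation "P \<equiv> prod_topology X (euclidean :: 'a topology)"
abbreviation "L \<equiv> fractafold_bundle N F K"
abbreviation "\<G> \<equiv> rd_groupoid X stl"

section \<open>Word maps are homeomorphisms\<close>

lemma lipschitz_bounds:
  assumes "i \<in> {1..N}"
  obtains r R where "0 < r" "\<And>t t'. r * dist t t' \<le> dist (F i t) (F i t')"
    "\<And>t t'. dist (F i t) (F i t') \<le> R * dist t t'"
  using nondegenerate assms unfolding nondegenerate_ifs_def by metis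

lemma inj:
  assumes "i \<in> {1..N}"
  shows "inj (F i)"
proof (rule injI)
  fix t t' assume *: "F i t = F i t'"
  obtain r where "0 < r" "r * dist t t' \<le> dist (F i t) (F i t')"
    using lipschitz_bounds[OF assms] by metis
  then have "dist t t' \<le> 0" using * by (simp add: mult_le_0_iff)
  then show "t = t'" by simp
qed

lemma continuous_F:
  assumes "i \<in> {1..N}"
  shows "continuous_on UNIV (F i)"
proof -
  obtain R where R: "\<And>t t'. dist (F i t) (F i t') \<le> R * dist t t'"
    using lipschitz_bounds[OF assms] by metis
  \<comment> \<open>A Lipschitz constant must be nonnegative, and the bound just obtained does not
    record the sign of \<open>R\<close>.\<close>
  have "dist (F i t) (F i t') \<le> max 0 R * dist t t'" for t t'
    using R[of t t'] by (smt (verit) mult_right_mono zero_le_dist)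
  then have "(max 0 R)-lipschitz_on UNIV (F i)"
    by (auto intro: lipschitz_onI)
  then show ?thesis by (rule lipschitz_on_continuous_on)
qed

text \<open>Applied to preimages, which exist by surjectivity, the lower bound of \<open>F i\<close>
  is an upper bound 1/r for its inverse.\<close>

lemma continuous_inv_F:
  assumes "i \<in> {1..N}"
  shows "continuous_on UNIV (inv (F i))"
proof -
  obtain r where r: "0 < r" "\<And>t t'. r * dist t t' \<le> dist (F i t) (F i t')"
    using lipschitz_bounds[OF assms] by metis
  have "dist (inv (F i) s) (inv (F i) s') \<le> 1 / r * dist s s'" for s s'
    using r(1) r(2)[of "inv (F i) s" "inv (F i) s'"]
    by (simp add: surj_f_inv_f[OF surj[OF assms]] field_simps)
  then have "(1 / r)-lipschitz_on UNIV (inv (F i))"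
    using r(1) by (auto intro: lipschitz_onI)
  then show ?thesis by (rule lipschitz_on_continuous_on)
qed

lemma continuous_word_map: "set \<alpha> \<subseteq> {1..N} \<Longrightarrow> continuous_on UNIV (word_map F \<alpha>)"
proof (induction \<alpha>)
  case Nil
  have "word_map F [] = (\<lambda>t. t)" by (rule ext) simp
  then show ?case by simp
next
  case (Cons i \<alpha>)
  then have "continuous_on UNIV (word_map F \<alpha>)" "continuous_on UNIV (F i)"
    using continuous_F[of i] by simp_all
  then have "continuous_on UNIV (\<lambda>t. word_map F \<alpha> (F i t))"
    by (rule continuous_on_compose2) simp
  moreover have "word_map F (i # \<alpha>) = (\<lambda>t. word_map F \<alpha> (F i t))" by (rule ext) simp
  ultimately show ?case by simp
qed

lemma continuous_word_map_inv: "set \<alpha> \<subseteq> {1..N} \<Longrightarrow> continuous_on UNIV (word_map_inv F \<alpha>)"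
proof (induction \<alpha>)
  case Nil
  have "word_map_inv F [] = (\<lambda>t. t)" by (rule ext) simp
  then show ?case by simp
next
  case (Cons i \<alpha>)
  then have "continuous_on UNIV (inv (F i))" "continuous_on UNIV (word_map_inv F \<alpha>)"
    using continuous_inv_F[of i] by simp_all
  then have "continuous_on UNIV (\<lambda>t. inv (F i) (word_map_inv F \<alpha> t))"
    by (rule continuous_on_compose2) simp
  moreover have "word_map_inv F (i # \<alpha>) = (\<lambda>t. inv (F i) (word_map_inv F \<alpha> t))" by (rule ext) simp
  ultimately show ?case by simp
qed

lemma word_map_inv_word_map [simp]:
  "set \<alpha> \<subseteq> {1..N} \<Longrightarrow> word_map_inv F \<alpha> (word_map F \<alpha> t) = t"
  by (induction \<alpha> arbitrary: t) (auto simp: inv_f_f inj)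

lemma word_map_word_map_inv [simp]:
  "set \<alpha> \<subseteq> {1..N} \<Longrightarrow> word_map F \<alpha> (word_map_inv F \<alpha> t) = t"
  by (induction \<alpha> arbitrary: t) (auto simp: surj_f_inv_f surj)

section \<open>The levels of the bundle and its open sets\<close>

lemma word_map_in_K: "set \<alpha> \<subseteq> {1..N} \<Longrightarrow> t \<in> K \<Longrightarrow> word_map F \<alpha> t \<in> K"
proof (induction \<alpha> arbitrary: t)
  case (Cons i \<alpha>)
  have "(\<Union>i\<in>{1..N}. F i ` K) \<subseteq> K"
    using invariant unfolding ifs_invariant_set_def by (metis order_refl)
  moreover have "i \<in> {1..N}" using Cons.prems by simp
  ultimately have "F i t \<in> K" using Cons.prems(2) by blast
  then show ?case using Cons by simp
qed simp

text \<open>The only word of length \<open>n\<close> whose cylinder contains \<open>x\<close> is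
  x(n). Replacing the inverse image by a condition on the forward map pays off because a longer
  prefix just applies further maps.\<close>

lemma mem_fractafold_level:
  "(x, t) \<in> fractafold_level N F K n \<longleftrightarrow> x \<in> streams {1..N} \<and> word_map F (stake n x) t \<in> K"
proof
  assume "(x, t) \<in> fractafold_level N F K n"
  then show "x \<in> streams {1..N} \<and> word_map F (stake n x) t \<in> K"
    by (auto simp: fractafold_level_def cylinder_def words_def)
next
  assume *: "x \<in> streams {1..N} \<and> word_map F (stake n x) t \<in> K"
  then have "t \<in> word_map_inv F (stake n x) ` K"
    by (metis imageI set_stake_subset word_map_inv_word_map)
  then show "(x, t) \<in> fractafold_level N F K n"
    using * set_stake_subset[of x "{1..N}" n]
    by (force simp: fractafold_level_def words_def)
qed

text \<open>The additional letters apply further maps to a point already in \<open>K\<close>, and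
  these preserve \<open>K\<close>.\<close>

lemma fractafold_level_mono:
  assumes "j \<le> k" "z \<in> fractafold_level N F K j"
  shows "z \<in> fractafold_level N F K k"
proof -
  obtain x t where z: "z = (x, t)" by (cases z)
  have x: "x \<in> streams {1..N}" "word_map F (stake j x) t \<in> K"
    using assms(2) by (simp_all only: z mem_fractafold_level)
  have "stake k x = stake j x @ stake (k - j) (sdrop j x)"
    using assms(1) by (metis le_add_diff_inverse stake_add)
  then have "word_map F (stake k x) t =
      word_map F (stake (k - j) (sdrop j x)) (word_map F (stake j x) t)"
    by (simp only: word_map_append)
  then show ?thesis
    using x word_map_in_K[OF set_stake_subset[OF sdrop_in_streams]]
    by (simp only: z mem_fractafold_level)
qed

lemma topspace_level: "topspace (fractafold_level_space N F K n) = fractafold_level N F K n"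
  by (auto simp: fractafold_level_space_def topspace_shift_space mem_fractafold_level)

lemma topspace_bundle: "topspace L = (\<Union>n. fractafold_level N F K n)"
proof -
  have "openin L (\<Union>n. fractafold_level N F K n)"
    unfolding fractafold_bundle_def openin_inductive_limit_topology topspace_level
    by (metis (no_types, lifting) UN_upper UNIV_I inf.absorb_iff2 openin_topspace order_refl
        topspace_level)
  moreover have "topspace L \<subseteq> (\<Union>n. fractafold_level N F K n)"
    using openin_topspace[of L]
    unfolding fractafold_bundle_def openin_inductive_limit_topology topspace_level by blast
  ultimately show ?thesis
    using openin_subset by blast
qed

lemma openin_bundle:
  "openin L U \<longleftrightarrow> U \<subseteq> topspace L \<and>
     (\<forall>n. openin (subtopology P (fractafold_level N F K n)) (U \<inter> fractafold_level N F K n))"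
  unfolding topspace_bundle
  unfolding fractafold_bundle_def openin_inductive_limit_topology topspace_level
  unfolding fractafold_level_space_def ..

lemma fst_in_streams: "z \<in> topspace L \<Longrightarrow> fst z \<in> streams {1..N}"
  by (cases z) (auto simp: topspace_bundle mem_fractafold_level)

section \<open>Transfer maps on the bundle\<close>

lemma bundle_transfer_level:
  assumes "z \<in> fractafold_level N F K j" "fst z \<in> cylinder N \<beta>" "length \<beta> \<le> j"
    "set \<alpha> \<subseteq> {1..N}"
  shows "bundle_transfer F \<alpha> \<beta> z \<in> fractafold_level N F K (length \<alpha> + (j - length \<beta>))"
proof -
  obtain y t where z: "z = (y, t)" by (cases z)
  let ?w = "sdrop (length \<beta>) y"
  have y: "y \<in> streams {1..N}" "stake (length \<beta>) y = \<beta>"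
    using assms(2) by (auto simp: z cylinder_def)
  \<comment> \<open>Let \<omega> be the part of y(j) after \<beta>. The new prefix is
    \<alpha>\<omega>, and following it the inverse of F_\<alpha> cancels, leaving F_\<omega>
    F_\<beta> t = F_{y(j)} t, a point of \<open>K\<close>.\<close>
  have "stake j y = \<beta> @ stake (j - length \<beta>) ?w"
    using assms(3) y by (metis le_add_diff_inverse stake_add)
  then show ?thesis
    using assms(1,4) y
    by (simp add: z bundle_transfer_def mem_fractafold_level shift_in_streams sdrop_in_streams
        stake_shift word_map_append)
qed

lemma continuous_map_bundle_transfer:
  assumes "set \<alpha> \<subseteq> {1..N}" "set \<beta> \<subseteq> {1..N}"
  shows "continuous_map P P (bundle_transfer F \<alpha> \<beta>)"
proof -
  have "continuous_on UNIV (\<lambda>t. word_map_inv F \<alpha> (word_map F \<beta> t))"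
    by (rule continuous_on_compose2[OF continuous_word_map_inv[OF assms(1)]
          continuous_word_map[OF assms(2)]]) simp
  then show ?thesis
    unfolding bundle_transfer_def
    using continuous_map_replace_prefix[OF assms(1)]
    by (simp add: continuous_map_prod_top)
qed

text \<open>Openness is tested level by level. From length \<beta> on, the part of a level over
  Z(\<beta>) goes into a single level, where \<open>U\<close> is the trace of an open set
  \<open>T\<close> of the product; \<open>T\<close> is pulled back by continuity on the product.
  Used with (\<alpha>, \<beta>) this yields continuity of the action, with the words exchanged its
  openness.\<close>

lemma openin_bundle_transfer_preimage:
  assumes O: "openin L U" and \<alpha>: "set \<alpha> \<subseteq> {1..N}" and \<beta>: "set \<beta> \<subseteq> {1..N}"
  shows "openin L {z \<in> topspace L. fst z \<in> cylinder N \<beta> \<and> bundle_transfer F \<alpha> \<beta> z \<in> U}"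
    (is "openin L ?Q")
proof -
  let ?M = "fractafold_level N F K"
  have big: "openin (subtopology P (?M j)) (?Q \<inter> ?M j)" if j: "length \<beta> \<le> j" for j
  proof -
    let ?i = "length \<alpha> + (j - length \<beta>)"
    obtain T where T: "openin P T" "U \<inter> ?M ?i = T \<inter> ?M ?i"
      using O unfolding openin_bundle openin_subtopology by blast
    let ?S = "{z \<in> topspace P. bundle_transfer F \<alpha> \<beta> z \<in> T}"
    have S: "openin P ?S"
      using openin_continuous_map_preimage[OF continuous_map_bundle_transfer[OF \<alpha> \<beta>] T(1)] .
    have C: "openin P (cylinder N \<beta> \<times> UNIV)"
      using openin_cylinder[OF \<beta>] by (simp add: openin_prod_Times_iff)
    have "?Q \<inter> ?M j = (?S \<inter> (cylinder N \<beta> \<times> UNIV)) \<inter> ?M j"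
    proof (intro set_eqI)
      fix z
      show "z \<in> ?Q \<inter> ?M j \<longleftrightarrow> z \<in> (?S \<inter> (cylinder N \<beta> \<times> UNIV)) \<inter> ?M j"
      proof (cases "z \<in> ?M j \<and> fst z \<in> cylinder N \<beta>")
        case True
        then have "bundle_transfer F \<alpha> \<beta> z \<in> ?M ?i"
          using bundle_transfer_level j \<alpha> by blast
        then have "bundle_transfer F \<alpha> \<beta> z \<in> U \<longleftrightarrow> bundle_transfer F \<alpha> \<beta> z \<in> T"
          using T(2) by blast
        moreover have "z \<in> topspace L" "z \<in> topspace P"
          using True by (cases z; auto simp: topspace_bundle cylinder_def topspace_shift_space)+
        ultimately show ?thesis using True by (cases z) auto
      qed (cases z; auto)
    qed
    then show ?thesis
      using S C unfolding openin_subtopology by blast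
  qed
  \<comment> \<open>A level too low for the previous argument is a subspace of the level
    \<open>length \<beta>\<close>, where openness is already known.\<close>
  have "openin (subtopology P (?M j)) (?Q \<inter> ?M j)" for j
  proof -
    let ?k = "max j (length \<beta>)"
    have sub: "?M j \<subseteq> ?M ?k" using fractafold_level_mono[OF max.cobounded1] by blast
    obtain T where "openin P T" "?Q \<inter> ?M ?k = T \<inter> ?M ?k"
      using big[of ?k] unfolding openin_subtopology by auto
    then show ?thesis
      using sub unfolding openin_subtopology by blast
  qed
  then show ?thesis
    unfolding openin_bundle by blast
qed

lemma openin_bundle_restrict:
  assumes "set \<beta> \<subseteq> {1..N}"
  shows "openin L {z \<in> topspace L. fst z \<in> cylinder N \<beta>}"
proof -
  \<comment> \<open>Replacing \<beta> by itself is the identity over Z(\<beta>), so this part of the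
    bundle is itself a preimage under a transfer map.\<close>
  have eq: "bundle_transfer F \<beta> \<beta> z = z" if "fst z \<in> cylinder N \<beta>" for z
    using that assms stake_sdrop[of "length \<beta>" "fst z"]
    by (cases z) (auto simp: bundle_transfer_def cylinder_def)
  have "{z \<in> topspace L. fst z \<in> cylinder N \<beta>} =
        {z \<in> topspace L. fst z \<in> cylinder N \<beta> \<and> bundle_transfer F \<beta> \<beta> z \<in> topspace L}"
    using eq by auto
  then show ?thesis
    using openin_bundle_transfer_preimage[OF openin_topspace assms assms] by simp
qed

section \<open>The projection is continuous and open\<close>

lemma continuous_map_projection: "continuous_map L X fst"
proof (rule continuous_map_pointwiseI)
  fix z assume z: "z \<in> topspace L"
  then show "fst z \<in> topspace X" unfolding topspace_shift_space by (rule fst_in_streams)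
  fix V assume "openin X V" "fst z \<in> V"
  then obtain p where "\<forall>m\<ge>p. cylinder N (stake m (fst z)) \<subseteq> V"
    using shift_space_local_base by blast
  then have "cylinder N (stake p (fst z)) \<subseteq> V" by simp
  then show "\<exists>U. openin L U \<and> z \<in> U \<and> fst ` U \<subseteq> V"
    using z fst_in_streams[OF z] openin_bundle_restrict[OF set_stake_subset]
    by (intro exI[of _ "{w \<in> topspace L. fst w \<in> cylinder N (stake p (fst z))}"]) auto
qed

lemma open_map_projection: "open_map L X fst"
  unfolding open_map_def
proof (intro allI impI)
  fix U assume U: "openin L U"
  show "openin X (fst ` U)"
  proof (subst openin_subopen, clarify)
    fix x t assume xt: "(x, t) \<in> U"
    then obtain n where n: "(x, t) \<in> fractafold_level N F K n"
      using openin_subset[OF U] by (auto simp: topspace_bundle)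
    obtain T where T: "openin P T" "U \<inter> fractafold_level N F K n = T \<inter> fractafold_level N F K n"
      using U unfolding openin_bundle openin_subtopology by blast
    then have "(x, t) \<in> T" using xt n by blast
    then obtain A B where AB: "openin X A" "x \<in> A" "t \<in> B" "A \<times> B \<subseteq> T"
      using T(1) unfolding openin_prod_topology_alt by metis
    have x: "x \<in> streams {1..N}" using n by (simp add: mem_fractafold_level)
    \<comment> \<open>A sequence sharing its first \<open>n\<close> letters with \<open>x\<close>
      has the same word map at level \<open>n\<close>, so \<open>t\<close> can be kept fixed while
      the base point moves.\<close>
    let ?C = "A \<inter> cylinder N (stake n x)"
    have "?C \<subseteq> fst ` U"
    proof
      fix w assume w: "w \<in> ?C"
      then have "(w, t) \<in> fractafold_level N F K n"
        using n by (auto simp: mem_fractafold_level cylinder_def)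
      moreover have "(w, t) \<in> T" using w AB by auto
      ultimately have "(w, t) \<in> U" using T by blast
      then show "w \<in> fst ` U" by force
    qed
    then show "\<exists>S. openin X S \<and> fst (x, t) \<in> S \<and> S \<subseteq> fst ` U"
      using AB x openin_cylinder[OF set_stake_subset[OF x]]
      by (intro exI[of _ ?C]) auto
  qed
qed


section \<open>The action\<close>

text \<open>Two representations \<open>k = m - n\<close> differ by a common extension of both words, which
  cancels in \<open>F\<^sub>\<alpha>\<inverse> \<circ> F\<^sub>\<beta>\<close>.\<close>

lemma transport_extend:
  assumes "x \<in> streams {1..N}" "sdrop m x = sdrop n y"
  shows "word_map_inv F (stake (m + j) x) (word_map F (stake (n + j) y) t) =
         word_map_inv F (stake m x) (word_map F (stake n y) t)"
proof -
  have "set (stake j (sdrop n y)) \<subseteq> {1..N}"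
    using assms by (metis set_stake_subset sdrop_in_streams)
  then show ?thesis
    unfolding stake_add[symmetric] word_map_append word_map_inv_append assms(2)
    by (simp only: word_map_inv_word_map)
qed

lemma transport_unique:
  assumes "x \<in> streams {1..N}" "sdrop m x = sdrop n y" "sdrop m' x = sdrop n' y"
    "int m - int n = int m' - int n'"
  shows "word_map_inv F (stake m x) (word_map F (stake n y) t) =
         word_map_inv F (stake m' x) (word_map F (stake n' y) t)"
proof -
  \<comment> \<open>Extending the first pair by \<open>m'\<close> letters and the second by
    \<open>m\<close> gives the same pair.\<close>
  have "n + m' = n' + m" using assms(4) by auto
  then show ?thesis
    using transport_extend[OF assms(1,2), of m' t] transport_extend[OF assms(1,3), of m t]
    by (metis add.commute)
qed

lemma bundle_action_eq:
  assumes "x \<in> streams {1..N}" "k = int m - int n" "sdrop m x = sdrop n y"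
  shows "bundle_action F (x, k, y) (y', t) =
           (x, word_map_inv F (stake m x) (word_map F (stake n y) t))"
proof -
  let ?Q = "\<lambda>(m, n). k = int m - int n \<and> sdrop m x = sdrop n y"
  obtain m' n' where mn: "(SOME p. ?Q p) = (m', n')" by (cases "SOME p. ?Q p")
  have "?Q (SOME p. ?Q p)"
    using assms by (intro someI[of ?Q "(m, n)"]) auto
  then have "k = int m' - int n'" "sdrop m' x = sdrop n' y"
    unfolding mn by auto
  then have "word_map_inv F (stake m x) (word_map F (stake n y) t) =
         word_map_inv F (stake m' x) (word_map F (stake n' y) t)"
    using assms transport_unique by metis
  then show ?thesis
    by (simp add: bundle_action_def mn)
qed

text \<open>All arrows of an arrow cylinder share the same two words, so there the action depends on
  the point of the bundle alone and topological questions reduce to the transfer map.\<close>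

lemma bundle_action_eq_transfer:
  assumes "(x', k, y') \<in> arrow_cylinder N m n x y"
  shows "bundle_action F (x', k, y') (y', t) = bundle_transfer F (stake m x) (stake n y) (y', t)"
proof -
  have *: "x' \<in> streams {1..N}" "k = int m - int n" "sdrop m x' = sdrop n y'"
    "stake m x' = stake m x" "stake n y' = stake n y"
    using assms by (auto simp: mem_arrow_cylinder)
  then have "x' = stake m x @- sdrop n y'" by (metis stake_sdrop)
  then show ?thesis
    using bundle_action_eq[OF *(1-3)] * by (simp add: bundle_transfer_def)
qed

section \<open>Continuity and openness of the action map\<close>

lemma topspace_action_domain:
  "topspace (action_domain \<G> L fst) =
     {((x, k, y), (y, t)) | x k y t. (x, k, y) \<in> rd_arrows (streams {1..N}) stl \<and> (y, t) \<in> topspace L}"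
  by (auto simp: action_domain_def topspace_rd_arrow_space_shift)

lemma bundle_transfer_in_bundle:
  assumes "z \<in> topspace L" "fst z \<in> cylinder N \<beta>" "set \<alpha> \<subseteq> {1..N}"
  shows "bundle_transfer F \<alpha> \<beta> z \<in> topspace L"
proof -
  obtain j where "z \<in> fractafold_level N F K j"
    using assms(1) by (auto simp: topspace_bundle)
  \<comment> \<open>The level is raised so that all of \<beta> lies within the prefix it
    reads.\<close>
  then have "z \<in> fractafold_level N F K (max j (length \<beta>))"
    using fractafold_level_mono by (meson max.cobounded1)
  then show ?thesis
    using bundle_transfer_level assms(2,3) unfolding topspace_bundle by (meson UN_I UNIV_I max.cobounded2)
qed

lemma arrow_in_arrow_cylinder:
  assumes "(x, k, y) \<in> rd_arrows (streams {1..N}) stl"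
  obtains m n where "(x, k, y) \<in> arrow_cylinder N m n x y"
  using assms by (auto simp: mem_rd_arrows_stl mem_arrow_cylinder)

lemma bundle_action_in_bundle:
  assumes "(x, k, y) \<in> rd_arrows (streams {1..N}) stl" "(y, t) \<in> topspace L"
  shows "bundle_action F (x, k, y) (y, t) \<in> topspace L"
proof -
  obtain m n where "(x, k, y) \<in> arrow_cylinder N m n x y"
    using arrow_in_arrow_cylinder[OF assms(1)] .
  moreover from this have "x \<in> streams {1..N}" "y \<in> streams {1..N}"
    by (auto simp: mem_arrow_cylinder)
  ultimately show ?thesis
    using assms by (simp add: bundle_action_eq_transfer bundle_transfer_in_bundle set_stake_subset)
qed

lemma openin_action_domain_Times:
  assumes "openin (arrow_space \<G>) A" "openin L B"
  shows "openin (action_domain \<G> L fst) ((A \<times> B) \<inter> {(g, z). src \<G> g = fst z})"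
  using assms unfolding action_domain_def
  by (intro openin_subtopology_Int) (simp add: openin_prod_Times_iff)

lemma continuous_map_bundle_action:
  "continuous_map (action_domain \<G> L fst) L (\<lambda>(g, z). bundle_action F g z)"
proof (rule continuous_map_pointwiseI)
  fix gz assume "gz \<in> topspace (action_domain \<G> L fst)"
  then obtain x k y t where gz: "gz = ((x, k, y), (y, t))"
    "(x, k, y) \<in> rd_arrows (streams {1..N}) stl" "(y, t) \<in> topspace L"
    by (auto simp: topspace_action_domain)
  show "(\<lambda>(g, z). bundle_action F g z) gz \<in> topspace L"
    using gz bundle_action_in_bundle by simp
  fix V assume V: "openin L V" "(\<lambda>(g, z). bundle_action F g z) gz \<in> V"
  obtain m n where mn: "(x, k, y) \<in> arrow_cylinder N m n x y"
    using arrow_in_arrow_cylinder[OF gz(2)] .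
  then have xy: "x \<in> streams {1..N}" "y \<in> streams {1..N}"
    by (auto simp: mem_arrow_cylinder)
  let ?\<alpha> = "stake m x" and ?\<beta> = "stake n y"
  \<comment> \<open>The arrow factor is a whole arrow cylinder; the constraint of landing in
    \<open>V\<close> falls entirely on the bundle factor.\<close>
  let ?Q = "{z \<in> topspace L. fst z \<in> cylinder N ?\<beta> \<and> bundle_transfer F ?\<alpha> ?\<beta> z \<in> V}"
  let ?U = "(arrow_cylinder N m n x y \<times> ?Q) \<inter> {(g, z). src \<G> g = fst z}"
  have "openin (action_domain \<G> L fst) ?U"
    using xy V by (intro openin_action_domain_Times openin_bundle_transfer_preimage)
      (auto simp: openin_arrow_cylinder dest: set_stake_subset)
  moreover have "gz \<in> ?U"
    using gz V mn xy bundle_action_eq_transfer[OF mn] by auto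
  moreover have "(\<lambda>(g, z). bundle_action F g z) ` ?U \<subseteq> V"
    using bundle_action_eq_transfer by fastforce
  ultimately show "\<exists>U. openin (action_domain \<G> L fst) U \<and> gz \<in> U \<and>
      (\<lambda>(g, z). bundle_action F g z) ` U \<subseteq> V"
    by blast
qed

lemma open_map_bundle_action:
  "open_map (action_domain \<G> L fst) L (\<lambda>(g, z). bundle_action F g z)"
  unfolding open_map_def
proof (intro allI impI)
  let ?act = "\<lambda>(g, z). bundle_action F g z"
  fix W assume W: "openin (action_domain \<G> L fst) W"
  show "openin L (?act ` W)"
  proof (subst openin_subopen, intro ballI)
    fix v assume "v \<in> ?act ` W"
    then obtain gz where gz: "gz \<in> W" "v = ?act gz" by blast
    then have "gz \<in> topspace (action_domain \<G> L fst)"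
      using openin_subset[OF W] by blast
    then obtain x k y t where g: "gz = ((x, k, y), (y, t))"
      "(x, k, y) \<in> rd_arrows (streams {1..N}) stl" "(y, t) \<in> topspace L"
      by (auto simp: topspace_action_domain)
    obtain T where T: "openin (prod_topology (arrow_space \<G>) L) T"
      "W = T \<inter> {(g, z). src \<G> g = fst z}"
      using W unfolding action_domain_def openin_subtopology by blast
    then obtain A B where AB: "openin (arrow_space \<G>) A" "openin L B" "(x, k, y) \<in> A" "(y, t) \<in> B"
      "A \<times> B \<subseteq> T"
      using gz(1) g(1) unfolding openin_prod_topology_alt by (metis IntD1)
    \<comment> \<open>For openness the cylinder has to fit into the given \<open>A\<close>, so an
      arbitrary representation of the arrow does not suffice; \<open>m\<close> and \<open>n\<close>
      are taken large.\<close>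
    obtain p where p: "\<forall>m n. p \<le> m \<longrightarrow> p \<le> n \<longrightarrow> k = int m - int n \<longrightarrow>
        sdrop m x = sdrop n y \<and> arrow_cylinder N m n x y \<subseteq> A"
      using rd_arrow_space_local_base AB by (metis rd_groupoid_sel(1))
    obtain m n where mn: "p \<le> m" "p \<le> n" "k = int m - int n"
      using int_diff_representatives by blast
    have xy: "x \<in> streams {1..N}" "y \<in> streams {1..N}"
      using g by (auto simp: mem_rd_arrows_stl)
    have drop: "sdrop m x = sdrop n y" and sub: "arrow_cylinder N m n x y \<subseteq> A"
      using p mn by blast+
    let ?\<alpha> = "stake m x" and ?\<beta> = "stake n y"
    note sets = set_stake_subset[OF xy(1), of m] set_stake_subset[OF xy(2), of n]
    \<comment> \<open>The image of \<open>B\<close> under the transfer from \<beta> to \<alpha> is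
      written as the preimage under the reverse transfer, whose openness is known.\<close>
    let ?Q = "{z \<in> topspace L. fst z \<in> cylinder N ?\<alpha> \<and> bundle_transfer F ?\<beta> ?\<alpha> z \<in> B}"
    have "openin L ?Q"
      using AB sets by (intro openin_bundle_transfer_preimage)
    moreover have "v \<in> ?Q"
    proof -
      have v: "v = (x, word_map_inv F ?\<alpha> (word_map F ?\<beta> t))"
        using gz g bundle_action_eq[OF xy(1) mn(3) drop] by simp
      have "?\<beta> @- sdrop m x = y" using drop by (metis stake_sdrop)
      then have "bundle_transfer F ?\<beta> ?\<alpha> v = (y, t)"
        using sets by (simp add: v bundle_transfer_def)
      moreover have "v \<in> topspace L"
        using gz g bundle_action_in_bundle by simp
      ultimately show ?thesis
        using AB xy by (simp add: v)
    qed
    moreover have "?Q \<subseteq> ?act ` W"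
    proof
      fix z assume z: "z \<in> ?Q"
      obtain x' s where z': "z = (x', s)" by (cases z)
      have x': "x' \<in> streams {1..N}" "stake m x' = ?\<alpha>"
        using z by (auto simp: z' cylinder_def)
      \<comment> \<open>The reverse transfer of \<open>z\<close> is the point to be acted on; the
        arrow leading back to \<open>z\<close> joins the two sequences with common tail
        \<open>sdrop m x'\<close>.\<close>
      define y' where "y' = ?\<beta> @- sdrop m x'"
      define t' where "t' = word_map_inv F ?\<beta> (word_map F ?\<alpha> s)"
      have yt: "(y', t') \<in> B"
        using z by (simp add: z' bundle_transfer_def y'_def t'_def)
      have g': "(x', k, y') \<in> arrow_cylinder N m n x y"
        using x' sets mn(3)
        by (simp add: mem_arrow_cylinder y'_def shift_in_streams sdrop_in_streams stake_shift sdrop_shift)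
      then have "((x', k, y'), (y', t')) \<in> W"
        using yt sub AB T by auto
      moreover have "?act ((x', k, y'), (y', t')) = z"
      proof -
        have "?\<alpha> @- sdrop n y' = x'"
          using x' stake_sdrop[of m x'] by (simp add: y'_def sdrop_shift)
        then show ?thesis
          using bundle_action_eq_transfer[OF g'] sets by (simp add: z' bundle_transfer_def t'_def)
      qed
      ultimately show "z \<in> ?act ` W" by force
    qed
    ultimately show "\<exists>T. openin L T \<and> v \<in> T \<and> T \<subseteq> ?act ` W"
      by blast
  qed
qed

section \<open>The axioms of an action\<close>

lemma bundle_action_mult:
  assumes "(x, k, y) \<in> rd_arrows (streams {1..N}) stl" "(y, l, w) \<in> rd_arrows (streams {1..N}) stl"
  shows "bundle_action F (x, k, y) (bundle_action F (y, l, w) (w, t)) =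
         bundle_action F (x, k + l, w) (w, t)"
proof -
  obtain m n a b where *: "k = int m - int n" "sdrop m x = sdrop n y"
    "l = int a - int b" "sdrop a y = sdrop b w" "x \<in> streams {1..N}" "y \<in> streams {1..N}"
    using assms by (auto simp: mem_rd_arrows_stl)
  \<comment> \<open>Both arrows are represented with \<open>n + a\<close> letters of
    \<open>y\<close>; the word map of that prefix and its inverse then meet in the composition and
    cancel.\<close>
  have k: "k = int (m + a) - int (n + a)" "sdrop (m + a) x = sdrop (n + a) y"
    using * sdrop_eq_mono by auto
  have l: "l = int (n + a) - int (b + n)" "sdrop (n + a) y = sdrop (b + n) w"
    using * sdrop_eq_mono[OF *(4), of n] by (auto simp: add.commute)
  have kl: "k + l = int (m + a) - int (b + n)" "sdrop (m + a) x = sdrop (b + n) w"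
    using k l by auto
  show ?thesis
    using set_stake_subset[OF *(6), of "n + a"]
    by (simp add: bundle_action_eq[OF *(5) k] bundle_action_eq[OF *(6) l] bundle_action_eq[OF *(5) kl])
qed

lemma left_action_bundle: "left_action \<G> L fst (bundle_action F)"
proof -
  interpret topological_groupoid \<G> by (rule topological_groupoid_shift)
  show ?thesis
  proof
    show "continuous_map L (unit_space \<G>) fst" "open_map L (unit_space \<G>) fst"
      using continuous_map_projection open_map_projection by simp_all
    show "continuous_map (action_domain \<G> L fst) L (\<lambda>(g, z). bundle_action F g z)"
      by (rule continuous_map_bundle_action)
    show "fst (bundle_action F g z) = rng \<G> g" for g z
      by (cases g; cases z) (simp add: bundle_action_def split: prod.split)
    show "bundle_action F h (bundle_action F g z) = bundle_action F (gmult \<G> h g) z"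
      if "(h, g) \<in> topspace (composable_space \<G>)" "(g, z) \<in> topspace (action_domain \<G> L fst)"
      for h g z
      using that bundle_action_mult
      by (cases h) (auto simp: topspace_action_domain composable_space_def topspace_rd_arrow_space_shift)
    \<comment> \<open>A unit is represented by m = n = 0, for which both words are empty.\<close>
    show "bundle_action F (unit_at \<G> (fst z)) z = z" if "z \<in> topspace L" for z
      using bundle_action_eq[of "fst z" 0 0 0 "fst z"] fst_in_streams[OF that] by (cases z) simp
  qed
qed

end

theorem theorem3p4:
  fixes N :: nat
    and F :: "nat \<Rightarrow> 'a::complete_space \<Rightarrow> 'a"
    and K :: "'a set"
  assumes "nondegenerate_ifs N F"
    and "\<forall>i\<in>{1..N}. surj (F i)"
    and "ifs_invariant_set N F K"
  shows "\<exists>act.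
     (\<forall>x y t m n.
        x \<in> streams {1..N} \<and> y \<in> streams {1..N} \<and> (stl ^^ m) x = (stl ^^ n) y \<and>
        (y, t) \<in> topspace (fractafold_bundle N F K) \<longrightarrow>
        act (x, int m - int n, y) (y, t) =
          (x, word_map_inv F (stake m x) (word_map F (stake n y) t))) \<and>
     left_action (rd_groupoid (shift_space N) stl) (fractafold_bundle N F K) fst act \<and>
     open_map
       (action_domain (rd_groupoid (shift_space N) stl) (fractafold_bundle N F K) fst)
       (fractafold_bundle N F K)
       (\<lambda>(g, z). act g z)"
proof -
  interpret surjective_ifs N F K
    using assms by unfold_locales auto
  show ?thesis
    using bundle_action_eq left_action_bundle open_map_bundle_action
    by (intro exI[of _ "bundle_action F"] conjI) (auto simp: stl_funpow)
qed

end
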